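(* Let $\lambda>-1$. For every $n\ge0$, the recurrence coefficients $\alpha_n=\alpha_n(t;\lambda)$ and $\beta_n=\beta_n(t;\lambda)$ of the monic orthogonal polynomials for the generalised Airy weight $\omega(x;t,\lambda)=x^{\lambda}\exp(-\tfrac13x^3+tx)$ on $(0,\infty)$, viewed as functions of $t\in\mathbb{R}$, satisfy the differential system $$\frac{\mathrm{d}^2\alpha_n}{\mathrm{d}t^2}+3\alpha_n\frac{\mathrm{d}\alpha_n}{\mathrm{d}t}+\alpha_n^3+(6\beta_n-t)\alpha_n=2n+\lambda+1,$$ \begin{align*} &\left(\frac{\mathrm{d}\alpha_n}{\mathrm{d}t}+\alpha_n^2+2\beta_n-t\right)\frac{\mathrm{d}^2\beta_n}{\mathrm{d}t^2}-\left(\frac{\mathrm{d}\beta_n}{\mathrm{d}t}\right)^2-\left(2\alpha_n\frac{\mathrm{d}\alpha_n}{\mathrm{d}t}+2\alpha_n^3-2t\alpha_n+2n+\lambda\right)\frac{\mathrm{d}\beta_n}{\mathrm{d}t}\\ &\qquad-\beta_n\left(\frac{\mathrm{d}\alpha_n}{\mathrm{d}t}\right)^2+4\beta_n^3-4t\beta_n^2+\left\{\alpha_n^4-2t\alpha_n^2+2(2n+\lambda)\alpha_n+t^2\right\}\beta_n=n(n+\lambda). \end{align*}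
   Context: The monic orthogonal polynomials $P_n(x)=P_n(x;t,\lambda)$ ($\deg P_n=n$) satisfy $\int_0^\infty P_m(x)P_n(x)\,x^{\lambda}\exp(-\tfrac13x^3+tx)\,\mathrm{d}x=0$ for $m\ne n$. The recurrence coefficients are defined by $xP_n(x)=P_{n+1}(x)+\alpha_nP_n(x)+\beta_nP_{n-1}(x)$ with $P_{-1}=0$, $P_0=1$ (so $\beta_n>0$ for $n\ge1$), with the convention $\beta_0=0$. *)

theory Defs
  imports "HOL-Analysis.Analysis" "HOL-Computational_Algebra.Polynomial"
begin

definition airy_weight :: "real \<Rightarrow> real \<Rightarrow> real \<Rightarrow> real" where
  "airy_weight lam t x = x powr lam * exp (- (x ^ 3) / 3 + t * x)"

definition monic_orthogonal_polys ::
  "(real \<Rightarrow> real) \<Rightarrow> (nat \<Rightarrow> real poly) \<Rightarrow> bool" where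
  "monic_orthogonal_polys w P \<longleftrightarrow>
     (\<forall>n. degree (P n) = n \<and> lead_coeff (P n) = 1) \<and>
     (\<forall>m n. m \<noteq> n \<longrightarrow>
        (LBINT x:{0<..}. poly (P m) x * poly (P n) x * w x) = 0)"

text \<open>
  The conventions \<open>P\<^sub>-\<^sub>1 = 0\<close> and \<open>\<beta>\<^sub>0 = 0\<close> are both built in:
  truncated subtraction would turn \<open>P (n - 1)\<close> into \<open>P 0\<close> at \<open>n = 0\<close>, so that
  case is treated separately.
\<close>

definition recurrence_coeffs ::
  "(nat \<Rightarrow> real poly) \<Rightarrow> (nat \<Rightarrow> real) \<Rightarrow> (nat \<Rightarrow> real) \<Rightarrow> bool" where
  "recurrence_coeffs P a b \<longleftrightarrow>
     b 0 = 0 \<and>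
     (\<forall>n. [:0, 1:] * P n =
        P (Suc n) + smult (a n) (P n) + smult (b n) (if n = 0 then 0 else P (n - 1)))"

end

theory Submission
  imports Defs "HOL-Real_Asymp.Real_Asymp"
begin

text \<open>
  The proof eliminates the neighbours \<open>\<alpha>\<^sub>n\<^sub>+\<^sub>1\<close>, \<open>\<alpha>\<^sub>n\<^sub>-\<^sub>1\<close>, \<open>\<beta>\<^sub>n\<^sub>+\<^sub>1\<close>, \<open>\<beta>\<^sub>n\<^sub>-\<^sub>1\<close> between two kinds of
  relations: a flow in \<open>t\<close> and discrete equations in \<open>n\<close>.

  Since \<open>t\<close> enters the weight only through the factor \<open>exp (t * x)\<close>, differentiating an integral
  against the weight inserts a factor \<open>x\<close>. Differentiating the orthogonality relations therefore
  gives the Toda equations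
  \<open>\<alpha>\<^sub>n' = \<beta>\<^sub>n\<^sub>+\<^sub>1 - \<beta>\<^sub>n\<close> and \<open>\<beta>\<^sub>n' = \<beta>\<^sub>n (\<alpha>\<^sub>n - \<alpha>\<^sub>n\<^sub>-\<^sub>1)\<close>
  (lemmas \<open>alpha_has_derivative\<close> and \<open>beta_has_derivative\<close>).

  The weight solves the Pearson equation \<open>x w' = (\<lambda> - x\<^sup>3 + t x) w\<close>, so integrating
  \<open>(x p(x) w(x))'\<close> over the half-line gives a linear identity for every polynomial \<open>p\<close>. The
  choices \<open>p = P\<^sub>n\<^sup>2\<close> and \<open>p = P\<^sub>n\<^sub>+\<^sub>1 P\<^sub>n\<close> give two equations in the recurrence coefficients
  (\<open>string_equation_diagonal\<close>, \<open>string_equation_offdiagonal\<close>). The diagonal one, rewritten with the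
  Toda equations, is the differential equation for \<open>\<alpha>\<^sub>n\<close>.

  The off-diagonal one contains \<open>\<alpha>\<^sub>0 + \<dots> + \<alpha>\<^sub>n\<close>. Differencing in \<open>n\<close> removes this sum. In terms of
  \<open>R\<^sub>n = \<alpha>\<^sub>n\<^sup>2 + \<beta>\<^sub>n + \<beta>\<^sub>n\<^sub>+\<^sub>1 - t\<close> and \<open>r\<^sub>n = \<beta>\<^sub>n (\<alpha>\<^sub>n + \<alpha>\<^sub>n\<^sub>-\<^sub>1) - n\<close>, the residues at the origin of the
  coefficients of the ladder operators, the two equations read
  \<open>r\<^sub>n\<^sub>+\<^sub>1 + r\<^sub>n - \<lambda> = - \<alpha>\<^sub>n R\<^sub>n\<close> and
  \<open>\<beta>\<^sub>n\<^sub>+\<^sub>1 R\<^sub>n\<^sub>+\<^sub>1 - \<beta>\<^sub>n R\<^sub>n\<^sub>-\<^sub>1 = - \<alpha>\<^sub>n (r\<^sub>n\<^sub>+\<^sub>1 - r\<^sub>n)\<close>.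
  Multiplying the first by \<open>r\<^sub>n\<^sub>+\<^sub>1 - r\<^sub>n\<close> and the second by \<open>R\<^sub>n\<close> makes the right-hand sides agree and
  the left-hand sides telescope, which yields
  \<open>r\<^sub>n\<^sup>2 - \<lambda> r\<^sub>n = \<beta>\<^sub>n R\<^sub>n R\<^sub>n\<^sub>-\<^sub>1\<close> (\<open>quadratic_identity\<close>). The Toda equations express \<open>r\<^sub>n\<close>, \<open>R\<^sub>n\<close> and
  \<open>\<beta>\<^sub>n R\<^sub>n\<^sub>-\<^sub>1\<close> by \<open>\<alpha>\<^sub>n\<close>, \<open>\<beta>\<^sub>n\<close> and their derivatives, and this identity turns into the
  differential equation for \<open>\<beta>\<^sub>n\<close>.
\<close>

section \<open>Moments of the generalised Airy weight\<close>

text \<open>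
  The exponent is an arbitrary real number, so that multiplication by \<open>x\<close> is the shift \<open>a + 1\<close>.
\<close>

definition airy_moment :: "real \<Rightarrow> real \<Rightarrow> real" where
  "airy_moment a t = (LBINT x:{0<..}. airy_weight a t x)"

lemma airy_weight_nonneg: "0 \<le> airy_weight a t x"
  by (simp add: airy_weight_def)

lemma airy_weight_pos: "0 < x \<Longrightarrow> 0 < airy_weight a t x"
  by (simp add: airy_weight_def)

lemma airy_weight_measurable [measurable]: "airy_weight a t \<in> borel_measurable borel"
  unfolding airy_weight_def by measurable

lemma airy_weight_mult_power:
  assumes "0 < x"
  shows "x ^ k * airy_weight a t x = airy_weight (a + real k) t x"
  using assms by (simp add: airy_weight_def powr_add powr_realpow)

text \<open>
  The term \<open>x ^ 3 / 3\<close> dominates every linear term: its tangent at \<open>s\<close> lies below it on the half-line, and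
  \<open>s = 2 + \<bar>t\<bar>\<close> makes the slope \<open>s\<^sup>2\<close> at least \<open>t + 1\<close>. The spare \<open>- x\<close> is the exponent of the
  Gamma integrand, to which the weight is compared for integrability.
\<close>

lemma cubic_exponent_bound:
  fixes t x :: real
  assumes "0 \<le> x"
  shows "- (x ^ 3) / 3 + t * x \<le> 2 / 3 * (2 + \<bar>t\<bar>) ^ 3 - x"
proof -
  define s where "s = 2 + \<bar>t\<bar>"
  have "0 \<le> (x - s)^2 * (x + 2 * s)"
    using assms by (simp add: s_def)
  also have "\<dots> = x ^ 3 - 3 * s\<^sup>2 * x + 2 * s ^ 3"
    by (simp add: power2_eq_square power3_eq_cube algebra_simps)
  finally have "s\<^sup>2 * x \<le> x ^ 3 / 3 + 2 / 3 * s ^ 3" by simp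
  moreover have "(t + 1) * x \<le> s\<^sup>2 * x"
  proof (rule mult_right_mono[OF _ assms])
    have "t + 1 \<le> s * 1" by (simp add: s_def)
    also have "\<dots> \<le> s * s" by (intro mult_left_mono) (auto simp: s_def)
    finally show "t + 1 \<le> s\<^sup>2" by (simp add: power2_eq_square)
  qed
  ultimately show ?thesis unfolding s_def[symmetric] by (simp add: algebra_simps)
qed

lemma airy_weight_integrable:
  assumes "a > -1"
  shows "set_integrable lborel {0<..} (airy_weight a t)"
proof -
  define C where "C = exp (2 / 3 * (2 + \<bar>t\<bar>) ^ 3)"
  have "(\<lambda>x::real. x powr a / exp x) integrable_on {0..}"
    using Gamma_integral_real[of "a + 1"] assms by (auto simp: integrable_on_def)
  hence "(\<lambda>x::real. x powr a / exp x) absolutely_integrable_on {0..}"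
    by (subst absolutely_integrable_on_iff_nonneg) auto
  hence "(\<lambda>x::real. x powr a / exp x) absolutely_integrable_on {0<..}"
    by (rule set_integrable_subset) auto
  hence int: "set_integrable lborel {0<..} (\<lambda>x::real. x powr a / exp x)"
    unfolding set_integrable_def by (subst (asm) integrable_completion) auto
  show ?thesis
  proof (rule set_integrable_bound)
    show "set_integrable lborel {0<..} (\<lambda>x. C * (x powr a / exp x))"
      using int by (intro set_integrable_mult_right)
    show "set_borel_measurable lborel {0<..} (airy_weight a t)"
      unfolding set_borel_measurable_def by measurable
    show "AE x in lborel. x \<in> {0<..} \<longrightarrow>
        norm (airy_weight a t x) \<le> norm (C * (x powr a / exp x))"
    proof (intro AE_I2 impI)
      fix x :: real assume "x \<in> {0<..}"
      hence "exp (- (x ^ 3) / 3 + t * x) \<le> C * exp (- x)"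
        using cubic_exponent_bound[of x t] by (simp add: C_def mult_exp_exp)
      hence "x powr a * exp (- (x ^ 3) / 3 + t * x) \<le> x powr a * (C * exp (- x))"
        by (rule mult_left_mono) simp
      thus "norm (airy_weight a t x) \<le> norm (C * (x powr a / exp x))"
        by (simp add: airy_weight_def C_def exp_minus field_simps abs_mult)
    qed
  qed
qed

text \<open>
  Everything follows from \<open>1 + v \<le> exp v\<close>, used at \<open>v = u\<close> and at \<open>v = - u\<close>.
\<close>

lemma exp_remainder_bounds:
  fixes u :: real
  shows "0 \<le> exp u - 1 - u" "exp u - 1 - u \<le> u\<^sup>2 * exp \<bar>u\<bar>"
proof -
  show "0 \<le> exp u - 1 - u" using exp_ge_add_one_self[of u] by linarith
  have "1 - u \<le> exp (- u)" using exp_ge_add_one_self[of "- u"] by simp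
  hence "(1 - u) * exp u \<le> exp (- u) * exp u" by (rule mult_right_mono) simp
  hence 1: "exp u - 1 \<le> u * exp u" by (simp add: exp_minus algebra_simps)
  show "exp u - 1 - u \<le> u\<^sup>2 * exp \<bar>u\<bar>"
  proof (cases "u \<ge> 0")
    case True
    have "exp u - 1 - u \<le> u * (exp u - 1)" using 1 by (simp add: algebra_simps)
    also have "\<dots> \<le> u * (u * exp u)" using True 1 by (intro mult_left_mono) auto
    finally show ?thesis using True by (simp add: power2_eq_square)
  next
    case False
    have "exp u - 1 - u \<le> u * (exp u - 1)" using 1 by (simp add: algebra_simps)
    also have "\<dots> \<le> u * u"
    proof (rule mult_left_mono_neg)
      show "u \<le> exp u - 1" using exp_ge_add_one_self[of u] by linarith
    qed (use False in simp)
    also have "\<dots> \<le> u * u * exp \<bar>u\<bar>"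
      using mult_left_mono[of 1 "exp \<bar>u\<bar>" "u * u"] by simp
    finally show ?thesis by (simp add: power2_eq_square)
  qed
qed

text \<open>
  Replacing \<open>t\<close> by \<open>t + h\<close> multiplies the weight by \<open>exp (h * x)\<close>. For \<open>\<bar>h\<bar> \<le> 1\<close> the error of the
  first order expansion of this factor is at most \<open>h\<^sup>2 x\<^sup>2 exp x\<close>, and the factors \<open>x\<^sup>2\<close> and \<open>exp x\<close>
  are absorbed by raising the parameters of the weight.
\<close>

lemma airy_moment_increment_bound:
  assumes "a > -1" "\<bar>h\<bar> \<le> 1"
  shows "\<bar>airy_moment a (t + h) - airy_moment a t - h * airy_moment (a + 1) t\<bar>
           \<le> h\<^sup>2 * airy_moment (a + 2) (t + 1)"
proof -
  have int: "set_integrable lborel {0<..} (airy_weight b s)" if "b \<ge> a" for b s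
    using that assms by (intro airy_weight_integrable) auto
  let ?g = "\<lambda>x. airy_weight a (t + h) x - airy_weight a t x - h * airy_weight (a + 1) t x"
  have g: "?g x = airy_weight a t x * (exp (h * x) - 1 - h * x)" if "x > 0" for x
    using that airy_weight_mult_power[OF that, of 1 a t, symmetric]
    by (simp add: airy_weight_def distrib_right exp_add exp_diff) (simp add: field_simps)
  have intg: "set_integrable lborel {0<..} ?g"
    by (intro set_integral_diff set_integrable_mult_right int) auto
  have "(LBINT x:{0<..}. ?g x) =
      airy_moment a (t + h) - airy_moment a t - h * airy_moment (a + 1) t"
    unfolding airy_moment_def by (simp add: set_integral_diff int set_integrable_mult_right)
  moreover have "0 \<le> (LBINT x:{0<..}. ?g x)"
    unfolding set_lebesgue_integral_def
  proof (intro Bochner_Integration.integral_nonneg)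
    fix x :: real
    show "0 \<le> indicat_real {0<..} x *\<^sub>R ?g x"
      using exp_remainder_bounds(1)[of "h * x"] g airy_weight_nonneg[of a t x]
      by (auto simp: indicator_def simp del: diff_ge_0_iff_ge)
  qed
  moreover have "(LBINT x:{0<..}. ?g x) \<le> (LBINT x:{0<..}. h\<^sup>2 * airy_weight (a + 2) (t + 1) x)"
  proof (intro set_integral_mono intg set_integrable_mult_right int)
    fix x :: real assume x: "x \<in> {0<..}"
    hence "exp \<bar>h * x\<bar> \<le> exp x" using assms mult_right_mono[of "\<bar>h\<bar>" 1 x] by (simp add: abs_mult)
    hence "(h * x)\<^sup>2 * exp \<bar>h * x\<bar> \<le> (h * x)\<^sup>2 * exp x" by (rule mult_left_mono) simp
    hence "?g x \<le> airy_weight a t x * ((h * x)\<^sup>2 * exp x)"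
      using g[of x] x exp_remainder_bounds(2)[of "h * x"] airy_weight_nonneg[of a t x]
      by (metis greaterThan_iff mult_left_mono order_trans)
    also have "\<dots> = h\<^sup>2 * (x ^ 2 * airy_weight a (t + 1) x)"
      by (simp add: airy_weight_def distrib_right exp_add exp_diff) (simp add: field_simps)
    also have "\<dots> = h\<^sup>2 * airy_weight (a + 2) (t + 1) x"
      using airy_weight_mult_power[of x 2 a "t + 1"] x by simp
    finally show "?g x \<le> h\<^sup>2 * airy_weight (a + 2) (t + 1) x" .
  qed auto
  ultimately show ?thesis by (simp add: airy_moment_def)
qed

lemma airy_moment_has_derivative:
  assumes "a > -1"
  shows "(airy_moment a has_real_derivative airy_moment (a + 1) t) (at t)"
proof -
  let ?q = "\<lambda>h. (airy_moment a (t + h) - airy_moment a t) / h"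
  have "((\<lambda>h. ?q h - airy_moment (a + 1) t) \<longlongrightarrow> 0) (at 0)"
  proof (rule Lim_null_comparison)
    show "((\<lambda>h. \<bar>h\<bar> * airy_moment (a + 2) (t + 1)) \<longlongrightarrow> 0) (at 0)"
      by (auto intro!: tendsto_eq_intros)
    have "\<forall>\<^sub>F h :: real in at 0. dist h 0 < 1 \<and> h \<noteq> 0"
      unfolding eventually_at by (intro exI[of _ 1]) auto
    thus "\<forall>\<^sub>F h in at 0. norm (?q h - airy_moment (a + 1) t)
              \<le> \<bar>h\<bar> * airy_moment (a + 2) (t + 1)"
    proof eventually_elim
      case (elim h)
      have "?q h - airy_moment (a + 1) t =
          (airy_moment a (t + h) - airy_moment a t - h * airy_moment (a + 1) t) / h"
        using elim by (simp add: field_simps)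
      also have "\<bar>\<dots>\<bar> \<le> h\<^sup>2 * airy_moment (a + 2) (t + 1) / \<bar>h\<bar>"
        unfolding abs_divide
        using elim airy_moment_increment_bound[OF assms, of h t] by (intro divide_right_mono) auto
      also have "\<dots> = \<bar>h\<bar> * airy_moment (a + 2) (t + 1)"
        using elim by (simp add: field_simps power2_eq_square)
      finally show ?case by simp
    qed
  qed
  thus ?thesis unfolding DERIV_def by (subst (asm) LIM_zero_iff)
qed

text \<open>
  The Pearson equation in terms of moments: the integrand below is the derivative of
  \<open>x powr (a + 1) * exp (- x ^ 3 / 3 + t * x)\<close>, which vanishes at both ends of the half-line
  because \<open>a + 1 > 0\<close>.
\<close>

lemma airy_moment_recurrence:
  assumes "a > -1"
  shows "airy_moment (a + 3) t = (a + 1) * airy_moment a t + t * airy_moment (a + 1) t"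
proof -
  have int: "set_integrable lborel {0<..} (airy_weight b t)" if "b \<ge> a" for b
    using that assms by (intro airy_weight_integrable) auto
  let ?g = "\<lambda>x. (a + 1) * airy_weight a t x - airy_weight (a + 3) t x + t * airy_weight (a + 1) t x"
  have intg: "set_integrable lborel {0<..} ?g"
    by (intro set_integral_diff set_integral_add set_integrable_mult_right int) auto
  have "(LBINT x=0..\<infinity>. ?g x) = 0 - 0"
  proof (rule interval_integral_FTC_integrable)
    fix x :: real assume "0 < ereal x"
    hence x: "x > 0" by (simp add: zero_ereal_def)
    have "(airy_weight (a + 1) t has_real_derivative
        (a + 1) * airy_weight a t x + airy_weight (a + 1) t x * (t - x\<^sup>2)) (at x)"
      unfolding airy_weight_def
      by (rule derivative_eq_intros refl x | use x in \<open>simp add: field_simps powr_add\<close>)+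
    moreover have "airy_weight (a + 1) t x * x\<^sup>2 = airy_weight (a + 3) t x"
      using airy_weight_mult_power[OF x, of 2 "a + 1" t] by (simp add: mult.commute add.assoc)
    ultimately show "(airy_weight (a + 1) t has_vector_derivative ?g x) (at x)"
      by (simp add: has_real_derivative_iff_has_vector_derivative[symmetric] algebra_simps)
    show "isCont ?g x"
      unfolding airy_weight_def using x by (intro continuous_intros) auto
  next
    show "set_integrable lborel (einterval 0 \<infinity>) ?g"
      using intg by (simp add: zero_ereal_def)
    have "(airy_weight (a + 1) t \<longlongrightarrow> 0) (at_right 0)"
      unfolding airy_weight_def using assms by real_asymp
    thus "((airy_weight (a + 1) t \<circ> real_of_ereal) \<longlongrightarrow> 0) (at_right 0)"
      by (simp add: zero_ereal_def ereal_tendsto_simps)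
    have "(airy_weight (a + 1) t \<longlongrightarrow> 0) at_top"
      unfolding airy_weight_def by real_asymp
    thus "((airy_weight (a + 1) t \<circ> real_of_ereal) \<longlongrightarrow> 0) (at_left \<infinity>)"
      by (simp add: ereal_tendsto_simps)
  qed auto
  hence "(LBINT x:{0<..}. ?g x) = 0"
    by (simp add: interval_lebesgue_integral_0_infty)
  thus ?thesis
    unfolding airy_moment_def
    by (simp add: set_integral_diff set_integral_add int set_integrable_mult_right)
qed

section \<open>Monic orthogonal polynomials of a positive functional\<close>

definition X :: "real poly" where "X = [:0, 1:]"

lemma poly_X [simp]: "poly X x = x"
  by (simp add: X_def)

lemma coeff_X_mult: "coeff (X * p) i = (if i = 0 then 0 else coeff p (i - 1))"
  by (cases i) (simp_all add: X_def)

text \<open>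
  The functional \<open>L\<close> stands for integration against a weight. Truncated subtraction makes
  \<open>P (n - 1)\<close> equal to \<open>P 0\<close> at \<open>n = 0\<close>; its coefficient \<open>b 0 = 0\<close> lets the recurrence hold for all
  \<open>n\<close> without a separate case.
\<close>

locale monic_orthogonal_system =
  fixes L :: "real poly \<Rightarrow> real" and P :: "nat \<Rightarrow> real poly" and a b :: "nat \<Rightarrow> real"
  assumes L_add: "L (p + q) = L p + L q"
    and L_smult: "L (smult c p) = c * L p"
    and L_pos: "p \<noteq> 0 \<Longrightarrow> 0 < L (p * p)"
    and deg: "degree (P n) = n"
    and monic: "coeff (P n) n = 1"
    and orth: "m \<noteq> n \<Longrightarrow> L (P m * P n) = 0"
    and X_mult_P: "X * P n = P (Suc n) + smult (a n) (P n) + smult (b n) (P (n - 1))"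
    and b_0: "b 0 = 0"
begin

definition h :: "nat \<Rightarrow> real" where "h n = L (P n * P n)"

lemma L_0 [simp]: "L 0 = 0"
  using L_smult[of 0 0] by simp

lemma L_diff: "L (p - q) = L p - L q"
  using L_add[of p "- q"] L_smult[of "-1" q] by simp

lemma h_pos: "0 < h n"
  unfolding h_def using monic[of n] by (intro L_pos) auto

lemma coeff_P_above: "n < i \<Longrightarrow> coeff (P n) i = 0"
  by (simp add: coeff_eq_0 deg)

text \<open>
  The coefficients, instead of the degree, carry the assumption here, so that polynomials such as
  \<open>X * pderiv p\<close> and coefficientwise derivatives are covered with the zero polynomial included.
  The induction removes the top coefficient of \<open>q\<close> by a multiple of some \<open>P m\<close>.
\<close>

lemma L_mult_P_lower:
  assumes "\<And>i. i \<ge> n \<Longrightarrow> coeff q i = 0"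
  shows "L (q * P n) = 0"
proof -
  have "L (q * P n) = 0" if "m \<le> n" "\<And>i. i \<ge> m \<Longrightarrow> coeff q i = 0" for m q
    using that
  proof (induction m arbitrary: q)
    case 0
    hence "q = 0" by (simp add: poly_eq_iff)
    thus ?case by simp
  next
    case (Suc m)
    let ?r = "q - smult (coeff q m) (P m)"
    have "L (?r * P n) = 0"
    proof (rule Suc.IH)
      fix i assume "m \<le> i"
      show "coeff ?r i = 0"
      proof (cases "i = m")
        case False
        with \<open>m \<le> i\<close> show ?thesis by (simp add: coeff_P_above Suc.prems)
      qed (simp add: monic)
    qed (use Suc.prems in simp)
    moreover have "L (P m * P n) = 0" using Suc.prems by (intro orth) auto
    ultimately show ?case by (simp add: left_diff_distrib L_diff L_smult)
  qed
  from this[of n q] assms show ?thesis by simp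
qed

lemma L_mult_P_leading:
  assumes "\<And>i. i > n \<Longrightarrow> coeff q i = 0"
  shows "L (q * P n) = coeff q n * h n"
proof -
  have "L ((q - smult (coeff q n) (P n)) * P n) = 0"
  proof (rule L_mult_P_lower)
    fix i assume "n \<le> i"
    thus "coeff (q - smult (coeff q n) (P n)) i = 0"
      using assms by (cases "i = n") (auto simp: monic coeff_P_above)
  qed
  thus ?thesis by (simp add: left_diff_distrib L_diff L_smult h_def)
qed

text \<open>
  Up to the factors \<open>h\<close>, the Jacobi matrix: multiplication by \<open>X\<close> in the basis \<open>P\<close>, which is
  tridiagonal.
\<close>

definition J :: "nat \<Rightarrow> nat \<Rightarrow> real" where "J m n = L (X * (P m * P n))"

lemma J_commute: "J m n = J n m"
  by (simp add: J_def mult.commute)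

lemma L_X_three_term_product:
  "L (X * ((P i + smult c (P j) + smult d (P k)) * (P i' + smult c' (P j') + smult d' (P k'))))
     = J i i' + c' * J i j' + d' * J i k'
       + c * J j i' + c * c' * J j j' + c * d' * J j k'
       + d * J k i' + d * c' * J k j' + d * d' * J k k'"
  by (simp add: J_def distrib_left distrib_right smult_add_right L_add L_smult mult.assoc)

lemma J_diag: "J n n = a n * h n"
proof -
  have "X * (P n * P n) = P (Suc n) * P n + smult (a n) (P n * P n) + smult (b n) (P (n - 1) * P n)"
    using X_mult_P[of n] by (simp add: mult.assoc[symmetric] distrib_right)
  moreover have "b n * L (P (n - 1) * P n) = 0"
    by (cases n) (auto simp: b_0 orth)
  ultimately show ?thesis by (simp add: L_add L_smult orth h_def J_def)
qed

lemma J_Suc: "J n (Suc n) = h (Suc n)"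
proof -
  have "L (X * P n * P (Suc n)) = coeff (X * P n) (Suc n) * h (Suc n)"
    by (rule L_mult_P_leading) (simp add: coeff_X_mult coeff_P_above)
  thus ?thesis by (simp add: coeff_X_mult monic mult.assoc J_def)
qed

lemma J_far:
  assumes "m + 1 < n"
  shows "J m n = 0"
proof -
  have "L (X * P m * P n) = 0"
    by (rule L_mult_P_lower) (use assms in \<open>simp add: coeff_X_mult coeff_P_above\<close>)
  thus ?thesis by (simp add: mult.assoc J_def)
qed

lemma h_Suc: "h (Suc n) = b (Suc n) * h n"
proof -
  have "X * (P n * P (Suc n)) = X * P (Suc n) * P n"
    by (simp only: ac_simps)
  hence "X * (P n * P (Suc n)) = P (Suc (Suc n)) * P n + smult (a (Suc n)) (P (Suc n) * P n)
      + smult (b (Suc n)) (P n * P n)"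
    unfolding X_mult_P by (simp add: distrib_right)
  thus ?thesis
    using J_Suc[of n] by (simp add: J_def L_add L_smult orth h_def)
qed

text \<open>
  Each step of the recurrence subtracts \<open>a n\<close> from the coefficient below the leading one.
\<close>

lemma subleading_coeff: "coeff (P (Suc n)) n = - (\<Sum>j\<le>n. a j)"
proof (induction n)
  case 0
  have "coeff (X * P 0) 0 = coeff (P 1 + smult (a 0) (P 0) + smult (b 0) (P (0 - 1))) 0"
    by (subst X_mult_P) simp
  thus ?case using monic[of 0] by (simp add: coeff_X_mult b_0)
next
  case (Suc n)
  have "coeff (X * P (Suc n)) (Suc n) = coeff (P (Suc (Suc n)) + smult (a (Suc n)) (P (Suc n))
      + smult (b (Suc n)) (P (Suc n - 1))) (Suc n)"
    by (subst X_mult_P) simp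
  thus ?case using Suc monic[of "Suc n"] by (simp add: coeff_X_mult coeff_P_above)
qed

end

section \<open>String equations from the Pearson equation\<close>

locale pearson_orthogonal_system = monic_orthogonal_system +
  fixes lam t :: real
  assumes pearson:
    "L (X * (X * (X * p))) = (lam + 1) * L p + L (X * pderiv p) + t * L (X * p)"
begin

text \<open>
  The Pearson identity for \<open>P n * P n\<close>. Two of the three factors \<open>X\<close> are expanded by the
  recurrence, one on each \<open>P n\<close>, which leaves entries of the tridiagonal \<open>J\<close>. The derivative
  contributes \<open>2 * n\<close>, as \<open>X * pderiv (P n)\<close> has leading coefficient \<open>n\<close>.
\<close>

lemma string_equation_diagonal:
  "a n ^ 3 + b (Suc n) * (2 * a n + a (Suc n)) + b n * (2 * a n + a (n - 1)) - t * a n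
     = 2 * real n + 1 + lam"
proof -
  have "L (X * (X * (X * (P n * P n)))) = L (X * ((X * P n) * (X * P n)))"
    by (simp add: ac_simps)
  also have "\<dots> = (a (Suc n) * h (Suc n) + 2 * a n * h (Suc n) + a n ^ 2 * (a n * h n))
      + 2 * (b n * J (n - 1) (Suc n))
      + 2 * a n * (b n * J (n - 1) n) + b n ^ 2 * J (n - 1) (n - 1)"
    unfolding X_mult_P L_X_three_term_product
    by (simp add: J_diag J_Suc J_commute[of "Suc n" n] J_commute[of "Suc n" "n - Suc 0"]
        J_commute[of n "n - Suc 0"] algebra_simps power2_eq_square)
  also have "b n * J (n - 1) (Suc n) = 0"
    by (cases n) (simp_all add: b_0 J_far)
  also have "b n * J (n - 1) n = b n * h n"
    by (cases n) (simp_all add: b_0 J_Suc)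
  also have "b n ^ 2 * J (n - 1) (n - 1) = b n * a (n - 1) * h n"
    by (cases n) (simp_all add: b_0 J_diag h_Suc power2_eq_square)
  finally have lhs: "L (X * (X * (X * (P n * P n)))) =
      (a n ^ 3 + b (Suc n) * (2 * a n + a (Suc n)) + b n * (2 * a n + a (n - 1))) * h n"
    by (simp add: h_Suc algebra_simps power2_eq_square power3_eq_cube)
  have "L (X * pderiv (P n) * P n) = coeff (X * pderiv (P n)) n * h n"
    by (rule L_mult_P_leading) (simp add: coeff_X_mult coeff_pderiv coeff_P_above)
  also have "coeff (X * pderiv (P n)) n = real n"
    by (cases n) (simp_all add: coeff_X_mult coeff_pderiv monic)
  finally have n: "L (X * pderiv (P n) * P n) = real n * h n" .
  have "X * pderiv (P n * P n) = X * pderiv (P n) * P n + X * pderiv (P n) * P n"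
    by (simp only: pderiv_mult distrib_left ac_simps)
  hence "L (X * pderiv (P n * P n)) = 2 * real n * h n"
    by (simp only: L_add n)
  with lhs pearson[of "P n * P n"] have
    "(a n ^ 3 + b (Suc n) * (2 * a n + a (Suc n)) + b n * (2 * a n + a (n - 1)) - t * a n) * h n
       = (2 * real n + 1 + lam) * h n"
    using J_diag[of n] by (simp add: J_def algebra_simps flip: h_def)
  thus ?thesis using h_pos[of n] by simp
qed

text \<open>
  The Pearson identity for \<open>P (Suc n) * P n\<close>. The sum on the left comes from the derivative of
  \<open>P (Suc n)\<close>: paired with \<open>P n\<close>, only the coefficient below its leading one survives.
\<close>

lemma string_equation_offdiagonal:
  "(\<Sum>j\<le>n. a j) = b (Suc n) *
     (a (Suc n) ^ 2 + a (Suc n) * a n + a n ^ 2 + b (Suc (Suc n)) + b (Suc n) + b n - t)"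
proof -
  have "L (X * (X * (X * (P (Suc n) * P n)))) = L (X * ((X * P (Suc n)) * (X * P n)))"
    by (simp add: ac_simps)
  also have "\<dots> = h (Suc (Suc n)) + a (Suc n) * (a (Suc n) * h (Suc n))
      + b (Suc n) * h (Suc n) + a (Suc n) * a n * h (Suc n) + b (Suc n) * a n * (a n * h n)
      + a n * J n (Suc (Suc n)) + b n * J (n - 1) (Suc (Suc n))
      + a (Suc n) * (b n * J (n - 1) (Suc n)) + b (Suc n) * (b n * J (n - 1) n)"
    unfolding X_mult_P L_X_three_term_product
    by (simp add: J_diag J_Suc J_commute[of "Suc (Suc n)" n] J_commute[of "Suc (Suc n)" "Suc n"]
        J_commute[of "Suc (Suc n)" "n - Suc 0"]
        J_commute[of "Suc n" n] J_commute[of "Suc n" "n - Suc 0"] J_commute[of n "n - Suc 0"] algebra_simps)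
  also have "J n (Suc (Suc n)) = 0"
    by (rule J_far) simp
  also have "J (n - 1) (Suc (Suc n)) = 0"
    by (rule J_far) simp
  also have "b n * J (n - 1) (Suc n) = 0"
    by (cases n) (simp_all add: b_0 J_far)
  also have "b n * J (n - 1) n = b n * h n"
    by (cases n) (simp_all add: b_0 J_Suc)
  finally have lhs: "L (X * (X * (X * (P (Suc n) * P n)))) = b (Suc n) *
      (a (Suc n) ^ 2 + a (Suc n) * a n + a n ^ 2 + b (Suc (Suc n)) + b (Suc n) + b n) * h n"
    by (simp add: h_Suc algebra_simps power2_eq_square)
  have "L (X * pderiv (P n) * P (Suc n)) = 0"
    by (rule L_mult_P_lower) (simp add: coeff_X_mult coeff_pderiv coeff_P_above)
  moreover have "L (X * pderiv (P (Suc n)) * P n) = (\<Sum>j\<le>n. a j) * h n"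
  proof -
    \<comment> \<open>Subtracting \<open>Suc n\<close> times \<open>P (Suc n)\<close>, which is orthogonal to \<open>P n\<close>, removes the leading term.\<close>
    let ?r = "X * pderiv (P (Suc n)) - smult (real (Suc n)) (P (Suc n))"
    have r: "coeff ?r i = (real i - real (Suc n)) * coeff (P (Suc n)) i" for i
      by (simp add: coeff_X_mult coeff_pderiv algebra_simps)
    have "L (?r * P n) = coeff ?r n * h n"
    proof (rule L_mult_P_leading)
      fix i assume "n < i"
      thus "coeff ?r i = 0"
        unfolding r by (cases "i = Suc n") (simp_all add: coeff_P_above)
    qed
    moreover have "L (P (Suc n) * P n) = 0" by (rule orth) simp
    ultimately show ?thesis
      unfolding r by (simp add: left_diff_distrib L_diff L_smult subleading_coeff)
  qed
  ultimately have "L (X * pderiv (P (Suc n) * P n)) = (\<Sum>j\<le>n. a j) * h n"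
    by (simp add: pderiv_mult distrib_left L_add ac_simps)
  moreover have "L (P (Suc n) * P n) = 0" by (rule orth) simp
  moreover have "L (X * (P (Suc n) * P n)) = b (Suc n) * h n"
    using J_Suc[of n] J_commute[of "Suc n" n] by (simp add: J_def h_Suc)
  ultimately have "(\<Sum>j\<le>n. a j) * h n = b (Suc n) *
     (a (Suc n) ^ 2 + a (Suc n) * a n + a n ^ 2 + b (Suc (Suc n)) + b (Suc n) + b n - t) * h n"
    using lhs pearson[of "P (Suc n) * P n"] by (simp add: algebra_simps)
  thus ?thesis using h_pos[of n] by simp
qed

text \<open>
  For \<open>lam > 0\<close>, \<open>R n\<close> and \<open>r n\<close> are \<open>lam\<close> times the integrals of \<open>P n * P n / x\<close> and
  \<open>P n * P (n - 1) / x\<close> against the weight, divided by \<open>h n\<close> and \<open>h (n - 1)\<close>, the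
  latter for \<open>n > 0\<close>. The formulas below result from integration by parts and make sense for all \<open>lam > -1\<close>, whereas the
  integrals diverge for \<open>lam \<le> 0\<close> in general.
\<close>

definition R :: "nat \<Rightarrow> real" where
  "R n = a n ^ 2 + b n + b (Suc n) - t"

definition r :: "nat \<Rightarrow> real" where
  "r n = b n * (a n + a (n - 1)) - real n"

text \<open>
  The diagonal string equation in terms of \<open>R\<close> and \<open>r\<close>.
\<close>

lemma r_sum: "r (Suc n) + r n = lam - a n * R n"
  using string_equation_diagonal[of n]
  by (simp add: r_def R_def algebra_simps power2_eq_square power3_eq_cube)

text \<open>
  The difference of two consecutive off-diagonal string equations, in which the sum of the \<open>a j\<close>
  reduces to \<open>a n\<close>.
\<close>

lemma b_R_difference: "b (Suc n) * R (Suc n) - b n * R (n - 1) = - a n * (r (Suc n) - r n)"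
proof (cases n)
  case 0
  thus ?thesis
    using string_equation_offdiagonal[of 0]
    by (simp add: r_def R_def b_0 algebra_simps power2_eq_square)
next
  case (Suc m)
  thus ?thesis
    using string_equation_offdiagonal[of n] string_equation_offdiagonal[of m]
    by (simp add: r_def R_def algebra_simps power2_eq_square)
qed

text \<open>
  Both sides have the same increment in \<open>n\<close>: by \<open>r_sum\<close> and \<open>b_R_difference\<close> it is
  \<open>- a n * R n * (r (Suc n) - r n)\<close>. Both vanish at \<open>n = 0\<close>.
\<close>

lemma quadratic_identity: "r n ^ 2 - lam * r n = b n * R n * R (n - 1)"
proof (induction n)
  case 0
  show ?case by (simp add: r_def b_0)
next
  case (Suc n)
  have "r (Suc n) ^ 2 - lam * r (Suc n) - (r n ^ 2 - lam * r n) =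
      (r (Suc n) - r n) * (r (Suc n) + r n - lam)"
    by (simp add: algebra_simps power2_eq_square)
  also have "\<dots> = R n * (- a n * (r (Suc n) - r n))"
    by (simp add: r_sum)
  also have "\<dots> = b (Suc n) * R (Suc n) * R n - b n * R n * R (n - 1)"
    by (subst b_R_difference[symmetric]) (simp add: algebra_simps)
  finally show ?case using Suc by simp
qed

end

section \<open>Integration of polynomials against the Airy weight\<close>

definition airy_functional :: "real \<Rightarrow> real \<Rightarrow> real poly \<Rightarrow> real" where
  "airy_functional lam t p = (LBINT x:{0<..}. poly p x * airy_weight lam t x)"

lemma set_integrable_finite_sum:
  fixes f :: "'i \<Rightarrow> 'a \<Rightarrow> real"
  assumes "\<And>i. i \<in> I \<Longrightarrow> set_integrable M A (f i)"
  shows "set_integrable M A (\<lambda>x. \<Sum>i\<in>I. f i x)"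
  using assms unfolding set_integrable_def scaleR_sum_right
  by (rule Bochner_Integration.integrable_sum)

lemma set_integral_finite_sum:
  fixes f :: "'i \<Rightarrow> 'a \<Rightarrow> real"
  assumes "\<And>i. i \<in> I \<Longrightarrow> set_integrable M A (f i)"
  shows "(LINT x:A|M. \<Sum>i\<in>I. f i x) = (\<Sum>i\<in>I. LINT x:A|M. f i x)"
  using assms unfolding set_integrable_def set_lebesgue_integral_def scaleR_sum_right
  by (rule Bochner_Integration.integral_sum)

lemma poly_airy_weight_expand:
  assumes "\<And>i. i > N \<Longrightarrow> coeff p i = 0" "0 < x"
  shows "poly p x * airy_weight lam t x = (\<Sum>i\<le>N. coeff p i * airy_weight (lam + real i) t x)"
proof -
  have "poly p x = (\<Sum>i\<le>N. coeff p i * x ^ i)"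
    unfolding poly_altdef
  proof (rule sum.mono_neutral_left)
    show "{..degree p} \<subseteq> {..N}"
      using assms(1)[of "degree p"] by (cases "p = 0") (auto simp: not_le[symmetric])
  qed (auto simp: coeff_eq_0)
  thus ?thesis
    by (simp add: sum_distrib_right mult.assoc airy_weight_mult_power[OF assms(2)])
qed

lemma poly_airy_weight_integrable:
  assumes "lam > -1"
  shows "set_integrable lborel {0<..} (\<lambda>x. poly p x * airy_weight lam t x)"
proof -
  have "set_integrable lborel {0<..}
      (\<lambda>x. \<Sum>i\<le>degree p. coeff p i * airy_weight (lam + real i) t x)"
    using assms
    by (intro set_integrable_finite_sum set_integrable_mult_right airy_weight_integrable) auto
  moreover have "poly p x * airy_weight lam t x =
      (\<Sum>i\<le>degree p. coeff p i * airy_weight (lam + real i) t x)" if "x \<in> {0<..}" for x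
    using that by (intro poly_airy_weight_expand) (auto simp: coeff_eq_0)
  ultimately show ?thesis
    by (subst set_integrable_cong[OF refl]) auto
qed

lemma airy_functional_expand:
  assumes "lam > -1" "\<And>i. i > N \<Longrightarrow> coeff p i = 0"
  shows "airy_functional lam t p = (\<Sum>i\<le>N. coeff p i * airy_moment (lam + real i) t)"
proof -
  have "airy_functional lam t p =
      (LBINT x:{0<..}. \<Sum>i\<le>N. coeff p i * airy_weight (lam + real i) t x)"
    unfolding airy_functional_def
    by (rule set_lebesgue_integral_cong)
       (auto intro!: poly_airy_weight_expand assms simp del: lessThan_iff)
  also have "\<dots> = (\<Sum>i\<le>N. (LBINT x:{0<..}. coeff p i * airy_weight (lam + real i) t x))"
    using assms(1)
    by (intro set_integral_finite_sum set_integrable_mult_right airy_weight_integrable) auto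
  finally show ?thesis by (simp add: airy_moment_def)
qed

lemma airy_functional_add:
  assumes "lam > -1"
  shows "airy_functional lam t (p + q) = airy_functional lam t p + airy_functional lam t q"
  unfolding airy_functional_def
  using set_integral_add(2)[OF poly_airy_weight_integrable[OF assms, of p t]
      poly_airy_weight_integrable[OF assms, of q t]]
  by (simp add: distrib_right)

lemma airy_functional_smult: "airy_functional lam t (smult c p) = c * airy_functional lam t p"
  by (simp add: airy_functional_def mult.assoc)

lemma airy_functional_X_mult: "airy_functional lam t (X * p) = airy_functional (lam + 1) t p"
  unfolding airy_functional_def
proof (intro set_lebesgue_integral_cong allI impI)
  fix x :: real assume "x \<in> {0<..}"
  thus "poly (X * p) x * airy_weight lam t x = poly p x * airy_weight (lam + 1) t x"
    using airy_weight_mult_power[of x 1 lam t] by (simp add: mult_ac)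
qed simp

lemma airy_functional_pearson:
  assumes "lam > -1"
  shows "airy_functional lam t (X * (X * (X * p))) = (lam + 1) * airy_functional lam t p
    + airy_functional lam t (X * pderiv p) + t * airy_functional lam t (X * p)"
proof -
  let ?N = "degree p"
  have N: "coeff p i = 0" if "i > ?N" for i
    using that by (simp add: coeff_eq_0)
  have "airy_functional lam t (X * (X * (X * p))) = airy_functional (lam + 3) t p"
    by (simp add: airy_functional_X_mult add.assoc)
  also have "\<dots> = (\<Sum>i\<le>?N. coeff p i * airy_moment (lam + real i + 3) t)"
    using assms by (subst airy_functional_expand[OF _ N]) (auto simp: add_ac)
  also have "\<dots> = (\<Sum>i\<le>?N. coeff p i * ((lam + 1 + real i) * airy_moment (lam + real i) t
      + t * airy_moment (lam + real i + 1) t))"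
  proof (rule sum.cong)
    fix i
    show "coeff p i * airy_moment (lam + real i + 3) t =
        coeff p i * ((lam + 1 + real i) * airy_moment (lam + real i) t
          + t * airy_moment (lam + real i + 1) t)"
      using assms by (subst airy_moment_recurrence) (auto simp: add_ac)
  qed simp
  also have "\<dots> = (lam + 1) * (\<Sum>i\<le>?N. coeff p i * airy_moment (lam + real i) t)
      + (\<Sum>i\<le>?N. coeff (X * pderiv p) i * airy_moment (lam + real i) t)
      + t * (\<Sum>i\<le>?N. coeff p i * airy_moment (lam + 1 + real i) t)"
  proof -
    have "coeff (X * pderiv p) i = real i * coeff p i" for i
      by (simp add: coeff_X_mult coeff_pderiv)
    thus ?thesis by (simp add: algebra_simps sum.distrib sum_distrib_left)
  qed
  also have "\<dots> = (lam + 1) * airy_functional lam t p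
      + airy_functional lam t (X * pderiv p) + t * airy_functional (lam + 1) t p"
  proof -
    have "coeff (X * pderiv p) i = 0" if "i > ?N" for i
      using that by (simp add: coeff_X_mult coeff_pderiv N)
    thus ?thesis
      using assms N by (subst (1 2 3) airy_functional_expand[of _ ?N]) auto
  qed
  finally show ?thesis by (simp add: airy_functional_X_mult)
qed

text \<open>
  A nonnegative integrand with zero integral vanishes almost everywhere, but this one is positive on
  the unit interval away from the finitely many roots of \<open>p\<close>.
\<close>

lemma airy_functional_square_pos:
  assumes "lam > -1" "p \<noteq> 0"
  shows "0 < airy_functional lam t (p * p)"
proof -
  let ?f = "\<lambda>x. indicat_real {0<..} x *\<^sub>R (poly (p * p) x * airy_weight lam t x)"
  have nonneg: "0 \<le> ?f x" for x
    by (simp add: airy_weight_nonneg indicator_def)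
  have int: "integrable lborel ?f"
    using poly_airy_weight_integrable[OF assms(1), of "p * p" t] by (simp add: set_integrable_def)
  have "integral\<^sup>L lborel ?f \<noteq> 0"
  proof
    assume "integral\<^sup>L lborel ?f = 0"
    hence "AE x in lborel. ?f x = 0"
      using integral_nonneg_eq_0_iff_AE[OF int] nonneg by simp
    moreover have "AE x in lborel. poly p x \<noteq> 0"
      using finite_imp_null_set_lborel[OF poly_roots_finite[OF assms(2)]]
      by (auto dest!: AE_not_in)
    ultimately have "AE x in lborel. x \<notin> {0<..<1::real}"
    proof eventually_elim
      case (elim x)
      thus ?case using airy_weight_pos[of x lam t] by (auto simp: indicator_def)
    qed
    hence "emeasure lborel {0<..<1::real} = 0"
      by (subst (asm) AE_iff_measurable[where N = "{0<..<1}"]) auto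
    thus False by simp
  qed
  moreover have "0 \<le> integral\<^sup>L lborel ?f"
    by (intro Bochner_Integration.integral_nonneg nonneg)
  ultimately show ?thesis
    unfolding airy_functional_def set_lebesgue_integral_def by linarith
qed

section \<open>Functionals of polynomials that depend on a parameter\<close>

text \<open>
  Differentiability is asked of the coefficients, which for a family of bounded degree amounts to
  differentiability in a finite-dimensional space of polynomials.
\<close>

definition has_coeff_derivative :: "(real \<Rightarrow> real poly) \<Rightarrow> real poly \<Rightarrow> real \<Rightarrow> bool" where
  "has_coeff_derivative q q' t \<longleftrightarrow>
     (\<forall>i. ((\<lambda>s. coeff (q s) i) has_real_derivative coeff q' i) (at t))"

lemma has_coeff_derivative_const: "has_coeff_derivative (\<lambda>s. p) 0 t"
  by (simp add: has_coeff_derivative_def)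

lemma has_coeff_derivative_diff:
  assumes "has_coeff_derivative p p' t" "has_coeff_derivative q q' t"
  shows "has_coeff_derivative (\<lambda>s. p s - q s) (p' - q') t"
  using assms by (auto simp: has_coeff_derivative_def intro!: DERIV_diff)

lemma has_coeff_derivative_smult:
  assumes "(c has_real_derivative c') (at t)" "has_coeff_derivative q q' t"
  shows "has_coeff_derivative (\<lambda>s. smult (c s) (q s)) (smult c' (q t) + smult (c t) q') t"
  using assms by (auto simp: has_coeff_derivative_def intro!: derivative_eq_intros)

lemma has_coeff_derivative_mult:
  assumes "has_coeff_derivative p p' t" "has_coeff_derivative q q' t"
  shows "has_coeff_derivative (\<lambda>s. p s * q s) (p' * q t + p t * q') t"
  using assms unfolding has_coeff_derivative_def coeff_mult coeff_add sum.distrib[symmetric]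
  by (intro allI DERIV_sum) (auto intro!: derivative_eq_intros)

text \<open>
  Product rule: the first term differentiates the polynomial, the second the weight. The degree bound
  \<open>N\<close> is common to all parameters, so that one finite sum of moments represents the functional.
\<close>

lemma airy_functional_has_derivative:
  assumes lam: "lam > -1" and q: "has_coeff_derivative q q' t"
    and N: "\<And>s i. i > N \<Longrightarrow> coeff (q s) i = 0"
  shows "((\<lambda>s. airy_functional lam s (q s)) has_real_derivative
           airy_functional lam t q' + airy_functional lam t (X * q t)) (at t)"
proof -
  have N': "coeff q' i = 0" if "i > N" for i
  proof (rule DERIV_unique)
    show "((\<lambda>s. coeff (q s) i) has_real_derivative coeff q' i) (at t)"
      using q by (simp add: has_coeff_derivative_def)
    show "((\<lambda>s. coeff (q s) i) has_real_derivative 0) (at t)"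
      using N[OF that] by simp
  qed
  have "((\<lambda>s. \<Sum>i\<le>N. coeff (q s) i * airy_moment (lam + real i) s) has_real_derivative
      (\<Sum>i\<le>N. coeff q' i * airy_moment (lam + real i) t
        + airy_moment (lam + real i + 1) t * coeff (q t) i)) (at t)"
    using q lam unfolding has_coeff_derivative_def
    by (intro DERIV_sum DERIV_mult airy_moment_has_derivative) auto
  also have "(\<Sum>i\<le>N. coeff q' i * airy_moment (lam + real i) t
        + airy_moment (lam + real i + 1) t * coeff (q t) i) =
      airy_functional lam t q' + airy_functional (lam + 1) t (q t)"
    using lam by (simp add: airy_functional_expand[OF _ N] airy_functional_expand[OF _ N']
        sum.distrib algebra_simps)
  finally show ?thesis
    using lam by (simp add: airy_functional_expand[OF lam N] airy_functional_X_mult)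
qed

section \<open>The Toda equations and the differential system\<close>

locale airy_orthogonal_family =
  fixes lam :: real and P :: "real \<Rightarrow> nat \<Rightarrow> real poly" and \<alpha> \<beta> :: "nat \<Rightarrow> real \<Rightarrow> real"
  assumes lam: "lam > -1"
    and ops: "monic_orthogonal_polys (airy_weight lam s) (P s)"
    and rec: "recurrence_coeffs (P s) (\<lambda>k. \<alpha> k s) (\<lambda>k. \<beta> k s)"
begin

sublocale S: pearson_orthogonal_system "airy_functional lam s" "P s" "\<lambda>k. \<alpha> k s" "\<lambda>k. \<beta> k s" lam s
  for s
proof
  fix m n :: nat and p q :: "real poly" and c
  show "airy_functional lam s (p + q) = airy_functional lam s p + airy_functional lam s q"
    by (rule airy_functional_add[OF lam])
  show "airy_functional lam s (smult c p) = c * airy_functional lam s p"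
    by (rule airy_functional_smult)
  show "0 < airy_functional lam s (p * p)" if "p \<noteq> 0"
    using that by (rule airy_functional_square_pos[OF lam])
  show "degree (P s n) = n"
    using ops[of s] by (simp add: monic_orthogonal_polys_def)
  thus "coeff (P s n) n = 1"
    using ops[of s] by (metis monic_orthogonal_polys_def)
  show "airy_functional lam s (P s m * P s n) = 0" if "m \<noteq> n"
    using ops[of s] that by (simp add: monic_orthogonal_polys_def airy_functional_def)
  show "\<beta> 0 s = 0"
    using rec[of s] by (simp add: recurrence_coeffs_def)
  show "X * P s n = P s (Suc n) + smult (\<alpha> n s) (P s n) + smult (\<beta> n s) (P s (n - 1))"
    using rec[of s] by (cases n) (simp_all add: recurrence_coeffs_def X_def)
  show "airy_functional lam s (X * (X * (X * p))) = (lam + 1) * airy_functional lam s p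
      + airy_functional lam s (X * pderiv p) + s * airy_functional lam s (X * p)"
    by (rule airy_functional_pearson[OF lam])
qed

lemma beta_0: "\<beta> 0 s = 0"
  by (rule S.b_0)

lemma coeff_PP_above: "i > m + n \<Longrightarrow> coeff (P s m * P s n) i = 0"
  using degree_mult_le[of "P s m" "P s n"] by (intro coeff_eq_0) (simp add: S.deg)

lemma alpha_eq: "\<alpha> n s = airy_functional lam s (X * (P s n * P s n)) / S.h s n"
  using S.J_diag[of s n] S.h_pos[of s n] by (simp add: S.J_def)

lemma beta_eq: "\<beta> (Suc n) s = S.h s (Suc n) / S.h s n"
  using S.h_Suc[of s n] S.h_pos[of s n] by simp

lemma h_differentiable:
  assumes "has_coeff_derivative (\<lambda>s. P s n) D t"
  shows "\<exists>d. ((\<lambda>s. S.h s n) has_real_derivative d) (at t)"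
  unfolding S.h_def
  using airy_functional_has_derivative[OF lam has_coeff_derivative_mult[OF assms assms]]
    coeff_PP_above by blast

lemma alpha_differentiable:
  assumes "has_coeff_derivative (\<lambda>s. P s n) D t"
  shows "\<exists>d. (\<alpha> n has_real_derivative d) (at t)"
proof -
  have "coeff (X * (P s n * P s n)) i = 0" if "i > 2 * n + 1" for s i
    using that by (simp add: coeff_X_mult coeff_PP_above)
  from airy_functional_has_derivative[OF lam has_coeff_derivative_mult[OF
        has_coeff_derivative_const has_coeff_derivative_mult[OF assms assms]] this]
  obtain d where d: "((\<lambda>s. airy_functional lam s (X * (P s n * P s n))) has_real_derivative d) (at t)"
    by blast
  obtain e where e: "((\<lambda>s. S.h s n) has_real_derivative e) (at t)"
    using h_differentiable[OF assms] by blast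
  have "\<alpha> n = (\<lambda>s. airy_functional lam s (X * (P s n * P s n)) / S.h s n)"
    by (rule ext) (rule alpha_eq)
  thus ?thesis using DERIV_divide[OF d e] S.h_pos[of t n] by fastforce
qed

lemma beta_differentiable:
  assumes "has_coeff_derivative (\<lambda>s. P s n) D t" "has_coeff_derivative (\<lambda>s. P s (n - 1)) D' t"
  shows "\<exists>d. (\<beta> n has_real_derivative d) (at t)"
proof (cases n)
  case 0
  have "\<beta> 0 = (\<lambda>s. 0)" by (rule ext) (rule beta_0)
  thus ?thesis using 0 by (auto intro!: exI[of _ 0])
next
  case (Suc m)
  obtain d e where "((\<lambda>s. S.h s n) has_real_derivative d) (at t)"
      "((\<lambda>s. S.h s m) has_real_derivative e) (at t)"
    using h_differentiable assms Suc by force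
  from DERIV_divide[OF this] S.h_pos[of t m] show ?thesis
    unfolding Suc beta_eq[abs_def] by fastforce
qed

text \<open>
  The formulas for \<open>\<alpha> m\<close> and \<open>\<beta> m\<close> involve only polynomials of index at most \<open>m\<close>, and the recurrence
  passes differentiability on to \<open>P s (Suc m)\<close>.
\<close>

lemma P_differentiable: "\<exists>D. has_coeff_derivative (\<lambda>s. P s n) D t"
proof (induction n rule: less_induct)
  case (less n)
  show ?case
  proof (cases n)
    case 0
    have "P s 0 = 1" for s
      using S.deg[of s 0] S.monic[of s 0] by (auto elim!: degree_eq_zeroE)
    thus ?thesis unfolding 0 using has_coeff_derivative_const[of 1 t] by auto
  next
    case (Suc m)
    obtain D D' where D: "has_coeff_derivative (\<lambda>s. P s m) D t"
        "has_coeff_derivative (\<lambda>s. P s (m - 1)) D' t"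
      using less.IH[of m] less.IH[of "m - 1"] Suc by fastforce
    obtain a' b' where ab: "(\<alpha> m has_real_derivative a') (at t)" "(\<beta> m has_real_derivative b') (at t)"
      using alpha_differentiable[OF D(1)] beta_differentiable[OF D] by blast
    have "P s (Suc m) = X * P s m - smult (\<alpha> m s) (P s m) - smult (\<beta> m s) (P s (m - 1))" for s
      unfolding S.X_mult_P by simp
    thus ?thesis unfolding Suc
      using has_coeff_derivative_diff[OF has_coeff_derivative_diff[OF
            has_coeff_derivative_mult[OF has_coeff_derivative_const[of X] D(1)]
            has_coeff_derivative_smult[OF ab(1) D(1)]] has_coeff_derivative_smult[OF ab(2) D(2)]]
      by auto
  qed
qed

text \<open>
  The leading coefficient is constant, hence the derivative of \<open>P s n\<close> in \<open>s\<close> has lower degree and is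
  orthogonal to \<open>P s n\<close>.
\<close>

lemma P_derivative_lower:
  assumes "has_coeff_derivative (\<lambda>s. P s n) D t" "n \<le> i"
  shows "coeff D i = 0"
proof (rule DERIV_unique)
  show "((\<lambda>s. coeff (P s n) i) has_real_derivative coeff D i) (at t)"
    using assms(1) by (simp add: has_coeff_derivative_def)
  have "(\<lambda>s. coeff (P s n) i) = (\<lambda>s. if i = n then 1 else 0)"
    using assms(2) S.monic S.coeff_P_above by auto
  thus "((\<lambda>s. coeff (P s n) i) has_real_derivative 0) (at t)" by simp
qed

lemma h_has_derivative: "((\<lambda>s. S.h s n) has_real_derivative \<alpha> n t * S.h t n) (at t)"
proof -
  obtain D where D: "has_coeff_derivative (\<lambda>s. P s n) D t"
    using P_differentiable by blast
  have 0: "airy_functional lam t (D * P t n) = 0"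
    by (rule S.L_mult_P_lower) (rule P_derivative_lower[OF D])
  have "((\<lambda>s. airy_functional lam s (P s n * P s n)) has_real_derivative
      airy_functional lam t (D * P t n + P t n * D) + airy_functional lam t (X * (P t n * P t n))) (at t)"
    by (rule airy_functional_has_derivative[OF lam has_coeff_derivative_mult[OF D D] coeff_PP_above])
  thus ?thesis
    using S.J_diag[of t n] 0
    by (simp only: S.h_def S.J_def S.L_add mult.commute[of "P t n" D]) simp
qed

lemma beta_has_derivative:
  "(\<beta> n has_real_derivative \<beta> n t * (\<alpha> n t - \<alpha> (n - 1) t)) (at t)"
proof (cases n)
  case 0
  have "\<beta> 0 = (\<lambda>s. 0)" by (rule ext) (rule beta_0)
  thus ?thesis using 0 by simp
next
  case (Suc m)
  have "\<beta> (Suc m) = (\<lambda>s. S.h s (Suc m) / S.h s m)"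
    by (rule ext) (rule beta_eq)
  moreover have "((\<lambda>s. S.h s (Suc m) / S.h s m) has_real_derivative
      \<beta> (Suc m) t * (\<alpha> (Suc m) t - \<alpha> m t)) (at t)"
    using S.h_pos[of t m]
    by (auto intro!: derivative_eq_intros h_has_derivative simp: beta_eq field_simps)
  ultimately show ?thesis using Suc by simp
qed

text \<open>
  The Toda equation for \<open>\<alpha>\<close> in summed form, from differentiating the orthogonality of \<open>P s (Suc n)\<close>
  and \<open>P s n\<close>. The derivative of \<open>P s (Suc n)\<close> has the derivative of the subleading coefficient
  as its top coefficient, that of \<open>P s n\<close> contributes nothing, and the weight contributes \<open>J\<close>.
\<close>

lemma sum_alpha_has_derivative:
  "((\<lambda>s. \<Sum>j\<le>n. \<alpha> j s) has_real_derivative \<beta> (Suc n) t) (at t)"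
proof -
  obtain D E where D: "has_coeff_derivative (\<lambda>s. P s n) D t"
    and E: "has_coeff_derivative (\<lambda>s. P s (Suc n)) E t"
    using P_differentiable by blast
  have "((\<lambda>s. airy_functional lam s (P s (Suc n) * P s n)) has_real_derivative
      airy_functional lam t (E * P t n + P t (Suc n) * D)
        + airy_functional lam t (X * (P t (Suc n) * P t n))) (at t)"
    by (rule airy_functional_has_derivative[OF lam has_coeff_derivative_mult[OF E D] coeff_PP_above])
  moreover have "(\<lambda>s. airy_functional lam s (P s (Suc n) * P s n)) = (\<lambda>s. 0)"
    by (rule ext) (rule S.orth, simp)
  ultimately have "airy_functional lam t (E * P t n + P t (Suc n) * D)
      + airy_functional lam t (X * (P t (Suc n) * P t n)) = 0"
    using DERIV_unique[OF _ DERIV_const] by metis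
  moreover have "airy_functional lam t (E * P t n) = coeff E n * S.h t n"
    by (rule S.L_mult_P_leading) (simp add: P_derivative_lower[OF E])
  moreover have "airy_functional lam t (D * P t (Suc n)) = 0"
    by (rule S.L_mult_P_lower) (simp add: P_derivative_lower[OF D])
  moreover have "airy_functional lam t (X * (P t (Suc n) * P t n)) = \<beta> (Suc n) t * S.h t n"
    using S.J_Suc[of t n] S.J_commute[of t "Suc n" n] by (simp add: S.J_def S.h_Suc)
  ultimately have "(coeff E n + \<beta> (Suc n) t) * S.h t n = 0"
    by (simp add: S.L_add mult.commute[of "P t (Suc n)" D] algebra_simps)
  hence E_n: "coeff E n = - \<beta> (Suc n) t"
    using S.h_pos[of t n] by simp
  have "((\<lambda>s. coeff (P s (Suc n)) n) has_real_derivative coeff E n) (at t)"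
    using E by (simp add: has_coeff_derivative_def)
  from DERIV_minus[OF this] show ?thesis
    by (simp add: S.subleading_coeff E_n)
qed

lemma alpha_has_derivative: "(\<alpha> n has_real_derivative \<beta> (Suc n) t - \<beta> n t) (at t)"
proof (cases n)
  case 0
  thus ?thesis using sum_alpha_has_derivative[of 0 t] by (simp add: beta_0)
next
  case (Suc m)
  from DERIV_diff[OF sum_alpha_has_derivative[of n t] sum_alpha_has_derivative[of m t]]
  show ?thesis by (simp add: Suc)
qed

lemma deriv_alpha: "deriv (\<alpha> n) = (\<lambda>s. \<beta> (Suc n) s - \<beta> n s)"
  by (rule ext) (rule DERIV_imp_deriv[OF alpha_has_derivative])

lemma deriv_beta: "deriv (\<beta> n) = (\<lambda>s. \<beta> n s * (\<alpha> n s - \<alpha> (n - 1) s))"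
  by (rule ext) (rule DERIV_imp_deriv[OF beta_has_derivative])

lemma deriv_alpha_has_derivative:
  "(deriv (\<alpha> n) has_real_derivative
      \<beta> (Suc n) t * (\<alpha> (Suc n) t - \<alpha> n t) - \<beta> n t * (\<alpha> n t - \<alpha> (n - 1) t)) (at t)"
  unfolding deriv_alpha
  using DERIV_diff[OF beta_has_derivative[of "Suc n" t] beta_has_derivative[of n t]] by simp

text \<open>
  At \<open>n = 0\<close> the Toda equation for \<open>\<alpha> (n - 1)\<close> takes a different form because of truncated subtraction,
  but there the factor \<open>\<beta> n t\<close> vanishes.
\<close>

lemma deriv_beta_has_derivative:
  "(deriv (\<beta> n) has_real_derivative
      \<beta> n t * (\<alpha> n t - \<alpha> (n - 1) t) ^ 2
        + \<beta> n t * (\<beta> (Suc n) t - 2 * \<beta> n t + \<beta> (n - 1) t)) (at t)"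
proof (cases n)
  case 0
  thus ?thesis unfolding deriv_beta by (simp add: beta_0)
next
  case (Suc m)
  have "((\<lambda>s. \<beta> n s * (\<alpha> n s - \<alpha> m s)) has_real_derivative
      \<beta> n t * ((\<beta> (Suc n) t - \<beta> n t) - (\<beta> (Suc m) t - \<beta> m t))
        + \<beta> n t * (\<alpha> n t - \<alpha> (n - 1) t) * (\<alpha> n t - \<alpha> m t)) (at t)"
    by (intro DERIV_mult' DERIV_diff beta_has_derivative alpha_has_derivative)
  thus ?thesis unfolding deriv_beta by (simp add: Suc algebra_simps power2_eq_square)
qed

lemma alpha_equation:
  "deriv (deriv (\<alpha> n)) t + 3 * \<alpha> n t * deriv (\<alpha> n) t + (\<alpha> n t) ^ 3
     + (6 * \<beta> n t - t) * \<alpha> n t = 2 * real n + lam + 1"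
  using S.string_equation_diagonal[where s = t and n = n]
  unfolding DERIV_imp_deriv[OF deriv_alpha_has_derivative] unfolding deriv_alpha
  by (simp add: algebra_simps)

lemma R_eq: "S.R t n = deriv (\<alpha> n) t + (\<alpha> n t) ^ 2 + 2 * \<beta> n t - t"
  by (simp add: S.R_def deriv_alpha)

text \<open>
  \<open>R\<^sub>n\<^sub>-\<^sub>1\<close> alone is not polynomial in \<open>\<alpha>\<^sub>n\<close>, \<open>\<beta>\<^sub>n\<close> and their derivatives. After multiplication by \<open>\<beta>\<^sub>n\<close>
  it is: the first derivative of \<open>\<beta>\<^sub>n\<close> provides \<open>\<beta>\<^sub>n \<alpha>\<^sub>n\<^sub>-\<^sub>1\<close> and the second provides \<open>\<beta>\<^sub>n \<beta>\<^sub>n\<^sub>-\<^sub>1\<close>.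
\<close>

lemma beta_mult_R_pred:
  "\<beta> n t * S.R t (n - 1) = deriv (deriv (\<beta> n)) t - 2 * \<alpha> n t * deriv (\<beta> n) t
     - \<beta> n t * deriv (\<alpha> n) t + (\<alpha> n t) ^ 2 * \<beta> n t + 2 * (\<beta> n t) ^ 2 - t * \<beta> n t"
proof (cases n)
  case 0
  show ?thesis
    unfolding DERIV_imp_deriv[OF deriv_beta_has_derivative] unfolding deriv_beta by (simp add: 0 beta_0)
next
  case (Suc m)
  show ?thesis
    unfolding DERIV_imp_deriv[OF deriv_beta_has_derivative] unfolding deriv_beta deriv_alpha
    by (simp add: Suc S.R_def algebra_simps power2_eq_square)
qed

lemma r_eq: "S.r t n = 2 * \<alpha> n t * \<beta> n t - deriv (\<beta> n) t - real n"
  by (simp add: S.r_def deriv_beta algebra_simps)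

lemma beta_equation:
  "(deriv (\<alpha> n) t + (\<alpha> n t) ^ 2 + 2 * \<beta> n t - t) * deriv (deriv (\<beta> n)) t
     - (deriv (\<beta> n) t) ^ 2
     - (2 * \<alpha> n t * deriv (\<alpha> n) t + 2 * (\<alpha> n t) ^ 3 - 2 * t * \<alpha> n t
          + 2 * real n + lam) * deriv (\<beta> n) t
     - \<beta> n t * (deriv (\<alpha> n) t) ^ 2
     + 4 * (\<beta> n t) ^ 3 - 4 * t * (\<beta> n t) ^ 2
     + ((\<alpha> n t) ^ 4 - 2 * t * (\<alpha> n t) ^ 2 + 2 * (2 * real n + lam) * \<alpha> n t + t ^ 2) * \<beta> n t
   = real n * (real n + lam)"
proof -
  have "S.r t n ^ 2 - lam * S.r t n = S.R t n * (\<beta> n t * S.R t (n - 1))"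
    using S.quadratic_identity[of t n] by (simp add: mult_ac)
  thus ?thesis
    unfolding beta_mult_R_pred unfolding r_eq R_eq by algebra
qed

end

theorem theorem3p14:
  fixes lam :: real
    and P :: "real \<Rightarrow> nat \<Rightarrow> real poly"
    and \<alpha> \<beta> :: "nat \<Rightarrow> real \<Rightarrow> real"
    and n :: nat and t :: real
  assumes "lam > -1"
    and "\<And>s. monic_orthogonal_polys (airy_weight lam s) (P s)"
    and "\<And>s. recurrence_coeffs (P s) (\<lambda>k. \<alpha> k s) (\<lambda>k. \<beta> k s)"
  shows "\<alpha> n differentiable (at t)
    \<and> deriv (\<alpha> n) differentiable (at t)
    \<and> \<beta> n differentiable (at t)
    \<and> deriv (\<beta> n) differentiable (at t)
    \<and> deriv (deriv (\<alpha> n)) t + 3 * \<alpha> n t * deriv (\<alpha> n) t + (\<alpha> n t) ^ 3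
           + (6 * \<beta> n t - t) * \<alpha> n t
         = 2 * real n + lam + 1
    \<and> (deriv (\<alpha> n) t + (\<alpha> n t) ^ 2 + 2 * \<beta> n t - t) * deriv (deriv (\<beta> n)) t
           - (deriv (\<beta> n) t) ^ 2
           - (2 * \<alpha> n t * deriv (\<alpha> n) t + 2 * (\<alpha> n t) ^ 3 - 2 * t * \<alpha> n t
                + 2 * real n + lam) * deriv (\<beta> n) t
           - \<beta> n t * (deriv (\<alpha> n) t) ^ 2
           + 4 * (\<beta> n t) ^ 3 - 4 * t * (\<beta> n t) ^ 2
           + ((\<alpha> n t) ^ 4 - 2 * t * (\<alpha> n t) ^ 2 + 2 * (2 * real n + lam) * \<alpha> n t + t ^ 2)
               * \<beta> n t
         = real n * (real n + lam)"
proof -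
  interpret airy_orthogonal_family lam P \<alpha> \<beta>
    using assms by unfold_locales
  have "\<alpha> n differentiable (at t)" "\<beta> n differentiable (at t)"
      "deriv (\<alpha> n) differentiable (at t)" "deriv (\<beta> n) differentiable (at t)"
    using alpha_has_derivative beta_has_derivative
      deriv_alpha_has_derivative deriv_beta_has_derivative
    unfolding real_differentiable_def by blast+
  with alpha_equation[of n t] beta_equation[of n t] show ?thesis by blast
qed

end
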